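(* Let $a<b$ be real numbers and let $f:[a,b]\to\mathbb{R}$ be a twice differentiable function such that there exist real constants $m$ and $M$ with $m\le f''(x)\le M$ for all $x\in[a,b]$. Then $$m\,\frac{\lambda(1-\lambda)}{2}(a-b)^2\le \lambda f(a)+(1-\lambda)f(b)-f(\lambda a+(1-\lambda)b)\le M\,\frac{\lambda(1-\lambda)}{2}(a-b)^2$$ for all $\lambda\in[0,1]$. *)

theory Defs
  imports "HOL-Analysis.Analysis"
begin

end

theory Submission
  imports Defs
begin

text \<open>
  Both inequalities come from the fact that a function with nonnegative second derivative lies
  below its chords.  The parabola \<open>q x = m * x\<^sup>2 / 2\<close> has second derivative \<open>m\<close>, and its gap between
  chord and graph is exactly \<open>m * (l * (1 - l) / 2) * (a - b)\<^sup>2\<close>.  If \<open>f'' \<ge> m\<close>, then \<open>f - q\<close> is convex, so the gap of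
  \<open>f\<close> is at least the gap of \<open>q\<close>; this is the lower bound.  The upper bound is the lower bound
  for \<open>-f\<close>, whose second derivative is at least \<open>-M\<close>.

  All derivatives are relative to the interval, hence one-sided at its endpoints.  Convexity is
  therefore derived from the mean value theorem in a form that needs only such derivatives
  (\<open>convex_on_if_deriv2_nonneg_within\<close>).
\<close>

text \<open>
  The slope of a chord over \<open>{x..z}\<close> is a value of \<open>g'\<close> at some point of \<open>{x..z}\<close>, the slope over
  \<open>{z..y}\<close> a value at a point that is no smaller.  As \<open>g'\<close> increases, the chord slopes of \<open>g\<close>
  increase, which is convexity.
\<close>
lemma convex_on_if_deriv2_nonneg_within:
  fixes g g' g'' :: "real \<Rightarrow> real"
  assumes S: "convex S"
    and g: "\<And>x. x \<in> S \<Longrightarrow> (g has_real_derivative g' x) (at x within S)"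
    and g': "\<And>x. x \<in> S \<Longrightarrow> (g' has_real_derivative g'' x) (at x within S)"
    and nonneg: "\<And>x. x \<in> S \<Longrightarrow> 0 \<le> g'' x"
  shows "convex_on S g"
proof (rule convex_on_linorderI)
  have sub: "{x..y} \<subseteq> S" if "x \<in> S" "y \<in> S" for x y
    using S that unfolding is_interval_convex_1[symmetric] is_interval_1
    by (meson atLeastAtMost_iff subsetI)
  have mean_value: "\<exists>u\<in>{x..y}. h y - h x = h' u * (y - x)"
    if "x \<in> S" "y \<in> S" "x \<le> y"
      and h: "\<And>u. u \<in> S \<Longrightarrow> (h has_real_derivative h' u) (at u within S)"
    for h h' :: "real \<Rightarrow> real" and x y
  proof (rule mvt_very_simple[OF \<open>x \<le> y\<close>])
    fix u assume "x \<le> u" "u \<le> y"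
    then have "u \<in> S" using sub[OF that(1,2)] by auto
    then show "(h has_derivative (*) (h' u)) (at u within {x..y})"
      using has_field_derivative_subset[OF h sub[OF that(1,2)]]
      by (simp add: has_field_derivative_def)
  qed
  have g'_mono: "g' u \<le> g' v" if uv: "u \<in> S" "v \<in> S" "u \<le> v" for u v
  proof -
    obtain w where "w \<in> {u..v}" "g' v - g' u = g'' w * (v - u)"
      using mean_value[OF uv g'] by blast
    moreover have "0 \<le> g'' w * (v - u)"
      using nonneg[of w] sub[of u v] uv \<open>w \<in> {u..v}\<close> by (intro mult_nonneg_nonneg) auto
    ultimately show ?thesis by linarith
  qed
  fix t x y :: real
  assume t: "0 < t" "t < 1" and xy: "x \<in> S" "y \<in> S" "x < y"
  define z where "z = (1 - t) * x + t * y"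
  have zx: "z - x = t * (y - x)" and yz: "y - z = (1 - t) * (y - x)"
    by (simp_all add: z_def algebra_simps)
  have "x \<le> z" "z \<le> y"
    using t xy mult_pos_pos[of t "y - x"] mult_pos_pos[of "1 - t" "y - x"] zx yz by linarith+
  then have "z \<in> S" using sub[OF xy(1,2)] by (meson atLeastAtMost_iff subsetD)
  obtain u where u: "u \<in> {x..z}" "g z - g x = g' u * (z - x)"
    using mean_value[OF xy(1) \<open>z \<in> S\<close> \<open>x \<le> z\<close> g] by blast
  obtain v where v: "v \<in> {z..y}" "g y - g z = g' v * (y - z)"
    using mean_value[OF \<open>z \<in> S\<close> xy(2) \<open>z \<le> y\<close> g] by blast
  have "g' u \<le> g' v"
    using u(1) v(1) sub[OF xy(1) \<open>z \<in> S\<close>] sub[OF \<open>z \<in> S\<close> xy(2)] by (intro g'_mono) auto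
  have "(1 - t) * g x + t * g y - g z = t * (g y - g z) - (1 - t) * (g z - g x)"
    by (simp add: algebra_simps)
  also have "\<dots> = t * (1 - t) * (y - x) * (g' v - g' u)"
    unfolding u(2) v(2) zx yz by (simp add: algebra_simps)
  also have "\<dots> \<ge> 0"
    using t xy \<open>g' u \<le> g' v\<close> by simp
  finally show "g ((1 - t) *\<^sub>R x + t *\<^sub>R y) \<le> (1 - t) * g x + t * g y"
    by (simp add: z_def)
qed (rule S)

text \<open>
  Strong convexity with modulus \<open>m\<close>: subtracting the parabola \<open>m * x\<^sup>2 / 2\<close> leaves a convex function,
  and the gap of the parabola is the bound.  For \<open>m < 0\<close> it instead limits how far \<open>f\<close> fails to be
  convex; an upper bound \<open>M > 0\<close> on the second derivative leads to this case, with \<open>m = -M\<close>.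
\<close>
lemma chord_gap_ge_if_deriv2_ge:
  fixes f f' f'' :: "real \<Rightarrow> real"
  assumes S: "convex S"
    and f: "\<And>x. x \<in> S \<Longrightarrow> (f has_real_derivative f' x) (at x within S)"
    and f': "\<And>x. x \<in> S \<Longrightarrow> (f' has_real_derivative f'' x) (at x within S)"
    and lower: "\<And>x. x \<in> S \<Longrightarrow> m \<le> f'' x"
    and ab: "a \<in> S" "b \<in> S" and l: "l \<in> {0..1}"
  shows "m * (l * (1 - l) / 2) * (a - b)\<^sup>2 \<le> l * f a + (1 - l) * f b - f (l * a + (1 - l) * b)"
proof -
  let ?g = "\<lambda>x. f x - m / 2 * x\<^sup>2"
  have "convex_on S ?g"
  proof (rule convex_on_if_deriv2_nonneg_within[OF S])
    fix x assume x: "x \<in> S"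
    show "(?g has_real_derivative f' x - m * x) (at x within S)"
      by (auto intro!: derivative_eq_intros f x)
    show "((\<lambda>x. f' x - m * x) has_real_derivative f'' x - m) (at x within S)"
      by (auto intro!: derivative_eq_intros f' x)
    show "0 \<le> f'' x - m" using lower[OF x] by simp
  qed
  then have "?g (l * a + (1 - l) * b) \<le> l * ?g a + (1 - l) * ?g b"
    using l ab convex_onD[of S ?g "1 - l" a b] by simp
  moreover have "l * (m / 2 * a\<^sup>2) + (1 - l) * (m / 2 * b\<^sup>2) - m / 2 * (l * a + (1 - l) * b)\<^sup>2
      = m * (l * (1 - l) / 2) * (a - b)\<^sup>2"
    by (simp add: field_simps power2_eq_square)
  ultimately show ?thesis by (simp only: right_diff_distrib)
qed

theorem theorem2p1:
  fixes a b m M :: real and f f' f'' :: "real \<Rightarrow> real"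
  assumes "a < b"
    and "\<And>x. x \<in> {a..b} \<Longrightarrow> (f has_real_derivative f' x) (at x within {a..b})"
    and "\<And>x. x \<in> {a..b} \<Longrightarrow> (f' has_real_derivative f'' x) (at x within {a..b})"
    and "\<And>x. x \<in> {a..b} \<Longrightarrow> m \<le> f'' x \<and> f'' x \<le> M"
  shows "\<forall>l\<in>{0..1}.
      m * (l * (1 - l) / 2) * (a - b)\<^sup>2 \<le> l * f a + (1 - l) * f b - f (l * a + (1 - l) * b) \<and>
      l * f a + (1 - l) * f b - f (l * a + (1 - l) * b) \<le> M * (l * (1 - l) / 2) * (a - b)\<^sup>2"
proof
  fix l :: real
  assume l: "l \<in> {0..1}"
  have ab: "a \<in> {a..b}" "b \<in> {a..b}" using assms(1) by auto
  have "m * (l * (1 - l) / 2) * (a - b)\<^sup>2 \<le> l * f a + (1 - l) * f b - f (l * a + (1 - l) * b)"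
    using assms(2-4) ab l
    by (intro chord_gap_ge_if_deriv2_ge[where S = "{a..b}" and f' = f' and f'' = f'']) auto
  moreover have "- M * (l * (1 - l) / 2) * (a - b)\<^sup>2
      \<le> l * - f a + (1 - l) * - f b - - f (l * a + (1 - l) * b)"
    using assms(2-4) ab l
    by (intro chord_gap_ge_if_deriv2_ge[where S = "{a..b}" and f = "\<lambda>x. - f x"
          and f' = "\<lambda>x. - f' x" and f'' = "\<lambda>x. - f'' x"])
       (auto intro: DERIV_minus)
  ultimately show "m * (l * (1 - l) / 2) * (a - b)\<^sup>2
        \<le> l * f a + (1 - l) * f b - f (l * a + (1 - l) * b) \<and>
      l * f a + (1 - l) * f b - f (l * a + (1 - l) * b) \<le> M * (l * (1 - l) / 2) * (a - b)\<^sup>2"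
    by simp
qed

end
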